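(* Let $n>2$ and $\mu\ge 1$ be integers and let $S$ be a uniform $(n\times n)/(\mu(n-1))$ semi-Latin square. Then the block designs $\Delta_1(S)$ and $\Delta_2(S)$ are affine resolvable $(\mu n^2,n^2,n,\mu n)$-designs, and the block design $\Delta_3(S)$ is an $(n^2,\mu n(n+1),\mu(n+1),n,\mu)$-BIBD, where $\Delta_1(S),\Delta_2(S),\Delta_3(S)$ are as defined in the context.
   Context: For integers $n>2$ and $k>0$, an $(n\times n)/k$ semi-Latin square is an $n\times n$ array of $k$-subsets (called blocks) of an $nk$-set (of treatments), such that each treatment occurs once in each row and once in each column of the array. It is uniform if every pair of blocks, not in the same row or column, intersect in the same positive number $\mu$ of treatments (in which case $k=\mu(n-1)$). A $(v,b,r,k)$-design is a block design with $v$ treatments and $b$ blocks (a list, repetitions allowed), each block being a $k$-subset of the set of treatments, such that each treatment is in exactly $r$ blocks. A $(v,b,r,k)$-design with $k<v$ and $r>1$ is resolvable if its collection of blocks can be partitioned into $r$ partitions of the treatments (called parallel classes), and such a resolvable design is affine resolvable if every pair of blocks in distinct parallel classes intersect in the same positive number of treatments. A $(v,b,r,k)$-design is a $(v,b,r,k,\lambda)$-balanced incomplete-block design (BIBD) if $1<k<v$ and every pair of distinct treatments occur together in exactly $\lambda$ blocks. The dual of a $(v,b,r,k)$-design is the $(b,v,k,r)$-design obtained by interchanging the roles of treatments and blocks. Let $\Delta(S)$ be the underlying block design of $S$, whose blocks are the $n^2$ cells of $S$. $\Delta_1(S)$ is obtained from $\Delta(S)$ by adding, for each row $R_i$ ($i=1,\ldots,n$)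 of $S$, $\mu$ new treatments $R_{i,1},\ldots,R_{i,\mu}$, each incident precisely with the blocks in row $R_i$. $\Delta_2(S)$ is obtained by the analogous construction with columns in place of rows. $\Delta_3(S)$ is obtained from $\Delta(S)$ by adding $\mu$ new treatments for each row and $\mu$ new treatments for each column (each new treatment being incident precisely with the blocks in its corresponding row or column), and then taking the dual. *)

theory Defs
  imports Main "HOL-Library.Disjoint_Sets"
begin

text \<open>
  A block design has a set of treatments and a family of blocks indexed by a set of labels;
  distinct labels may carry the same block, so repeated blocks are allowed and the dual is
  again a design.
\<close>

record ('t, 'b) block_design =
  treatments :: "'t set"
  labels :: "'b set"
  blk :: "'b \<Rightarrow> 't set"

definition is_design :: "('t, 'b) block_design \<Rightarrow> nat \<Rightarrow> nat \<Rightarrow> nat \<Rightarrow> nat \<Rightarrow> bool" where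
  "is_design D v b r k \<longleftrightarrow>
     finite (treatments D) \<and> card (treatments D) = v \<and>
     finite (labels D) \<and> card (labels D) = b \<and>
     (\<forall>x \<in> labels D. blk D x \<subseteq> treatments D \<and> card (blk D x) = k) \<and>
     (\<forall>t \<in> treatments D. card {x \<in> labels D. t \<in> blk D x} = r)"

text \<open>
  In a parallel class no block is repeated (injectivity) and the blocks partition the treatments.
\<close>

definition parallel_class :: "('t, 'b) block_design \<Rightarrow> 'b set \<Rightarrow> bool" where
  "parallel_class D C \<longleftrightarrow>
     C \<subseteq> labels D \<and> inj_on (blk D) C \<and> partition_on (treatments D) (blk D ` C)"

definition resolution :: "('t, 'b) block_design \<Rightarrow> nat \<Rightarrow> 'b set set \<Rightarrow> bool" where
  "resolution D r P \<longleftrightarrow>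
     partition_on (labels D) P \<and> card P = r \<and> (\<forall>C \<in> P. parallel_class D C)"

definition resolvable_design ::
    "('t, 'b) block_design \<Rightarrow> nat \<Rightarrow> nat \<Rightarrow> nat \<Rightarrow> nat \<Rightarrow> bool" where
  "resolvable_design D v b r k \<longleftrightarrow>
     is_design D v b r k \<and> k < v \<and> r > 1 \<and> (\<exists>P. resolution D r P)"

definition affine_resolvable_design ::
    "('t, 'b) block_design \<Rightarrow> nat \<Rightarrow> nat \<Rightarrow> nat \<Rightarrow> nat \<Rightarrow> bool" where
  "affine_resolvable_design D v b r k \<longleftrightarrow>
     resolvable_design D v b r k \<and>
     (\<exists>P. resolution D r P \<and>
        (\<exists>m > 0. \<forall>C \<in> P. \<forall>C' \<in> P. C \<noteq> C' \<longrightarrow>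
           (\<forall>x \<in> C. \<forall>y \<in> C'. card (blk D x \<inter> blk D y) = m)))"

definition is_BIBD ::
    "('t, 'b) block_design \<Rightarrow> nat \<Rightarrow> nat \<Rightarrow> nat \<Rightarrow> nat \<Rightarrow> nat \<Rightarrow> bool" where
  "is_BIBD D v b r k l \<longleftrightarrow>
     is_design D v b r k \<and> 1 < k \<and> k < v \<and>
     (\<forall>s \<in> treatments D. \<forall>t \<in> treatments D. s \<noteq> t \<longrightarrow>
        card {x \<in> labels D. s \<in> blk D x \<and> t \<in> blk D x} = l)"

definition dual_design :: "('t, 'b) block_design \<Rightarrow> ('b, 't) block_design" where
  "dual_design D =
     \<lparr>treatments = labels D, labels = treatments D,
      blk = (\<lambda>t. {x \<in> labels D. t \<in> blk D x})\<rparr>"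

text \<open>
  Adjoin (disjointly) a set \<open>X\<close> of new treatments, where \<open>x \<in> X\<close> is incident precisely with
  the blocks labelled by \<open>inc x\<close>.
\<close>

definition add_treatments ::
    "('t, 'b) block_design \<Rightarrow> 'x set \<Rightarrow> ('x \<Rightarrow> 'b set) \<Rightarrow> ('t + 'x, 'b) block_design" where
  "add_treatments D X inc =
     \<lparr>treatments = treatments D <+> X, labels = labels D,
      blk = (\<lambda>c. blk D c <+> {x \<in> X. c \<in> inc x})\<rparr>"

text \<open>
  An \<open>(n \<times> n)/k\<close> semi-Latin square with treatment set \<open>T\<close>: \<open>S i j\<close> is the block in
  row \<open>i\<close> and column \<open>j\<close>, for \<open>i, j \<in> {1..n}\<close>; values of \<open>S\<close> elsewhere are irrelevant.
\<close>

definition semi_latin_square ::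
    "nat \<Rightarrow> nat \<Rightarrow> 't set \<Rightarrow> (nat \<Rightarrow> nat \<Rightarrow> 't set) \<Rightarrow> bool" where
  "semi_latin_square n k T S \<longleftrightarrow>
     n > 2 \<and> k > 0 \<and> finite T \<and> card T = n * k \<and>
     (\<forall>i \<in> {1..n}. \<forall>j \<in> {1..n}. S i j \<subseteq> T \<and> card (S i j) = k) \<and>
     (\<forall>t \<in> T. \<forall>i \<in> {1..n}. \<exists>!j. j \<in> {1..n} \<and> t \<in> S i j) \<and>
     (\<forall>t \<in> T. \<forall>j \<in> {1..n}. \<exists>!i. i \<in> {1..n} \<and> t \<in> S i j)"

definition uniform_semi_latin_square ::
    "nat \<Rightarrow> nat \<Rightarrow> 't set \<Rightarrow> (nat \<Rightarrow> nat \<Rightarrow> 't set) \<Rightarrow> bool" where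
  "uniform_semi_latin_square n k T S \<longleftrightarrow>
     semi_latin_square n k T S \<and>
     (\<exists>m > 0. \<forall>i \<in> {1..n}. \<forall>j \<in> {1..n}. \<forall>i' \<in> {1..n}. \<forall>j' \<in> {1..n}.
        i \<noteq> i' \<longrightarrow> j \<noteq> j' \<longrightarrow> card (S i j \<inter> S i' j') = m)"

definition Delta ::
    "nat \<Rightarrow> 't set \<Rightarrow> (nat \<Rightarrow> nat \<Rightarrow> 't set) \<Rightarrow> ('t, nat \<times> nat) block_design" where
  "Delta n T S =
     \<lparr>treatments = T, labels = {1..n} \<times> {1..n}, blk = (\<lambda>(i, j). S i j)\<rparr>"

text \<open>
  New treatments are pairs \<open>(i, s)\<close>, the \<open>s\<close>-th of the \<open>\<mu>\<close> new treatments for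
  row (or column) \<open>i\<close>.
\<close>

definition add_rows ::
    "nat \<Rightarrow> nat \<Rightarrow> ('t, nat \<times> nat) block_design \<Rightarrow> ('t + nat \<times> nat, nat \<times> nat) block_design" where
  "add_rows n \<mu> D = add_treatments D ({1..n} \<times> {1..\<mu>}) (\<lambda>(i, s). {i} \<times> {1..n})"

definition add_columns ::
    "nat \<Rightarrow> nat \<Rightarrow> ('t, nat \<times> nat) block_design \<Rightarrow> ('t + nat \<times> nat, nat \<times> nat) block_design" where
  "add_columns n \<mu> D = add_treatments D ({1..n} \<times> {1..\<mu>}) (\<lambda>(j, s). {1..n} \<times> {j})"

definition Delta1 ::
    "nat \<Rightarrow> nat \<Rightarrow> 't set \<Rightarrow> (nat \<Rightarrow> nat \<Rightarrow> 't set) \<Rightarrow>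
     ('t + nat \<times> nat, nat \<times> nat) block_design" where
  "Delta1 n \<mu> T S = add_rows n \<mu> (Delta n T S)"

definition Delta2 ::
    "nat \<Rightarrow> nat \<Rightarrow> 't set \<Rightarrow> (nat \<Rightarrow> nat \<Rightarrow> 't set) \<Rightarrow>
     ('t + nat \<times> nat, nat \<times> nat) block_design" where
  "Delta2 n \<mu> T S = add_columns n \<mu> (Delta n T S)"

definition Delta3 ::
    "nat \<Rightarrow> nat \<Rightarrow> 't set \<Rightarrow> (nat \<Rightarrow> nat \<Rightarrow> 't set) \<Rightarrow>
     (nat \<times> nat, ('t + nat \<times> nat) + nat \<times> nat) block_design" where
  "Delta3 n \<mu> T S = dual_design (add_columns n \<mu> (add_rows n \<mu> (Delta n T S)))"

end

theory Submission
  imports Defs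
begin

text \<open>
  Fix a cell \<open>(i, j)\<close> and a row \<open>i' \<noteq> i\<close>. Each of the \<open>k\<close> treatments of the cell occurs
  exactly once in row \<open>i'\<close>, and not in column \<open>j\<close>; so the common intersection size \<open>m\<close> satisfies
  \<open>k = (n - 1) m\<close>, whence \<open>m = \<mu>\<close>. Two distinct cells in the same row share no treatment, and the
  \<open>\<mu>\<close> new treatments of that row make up for it. After adding the row treatments, the columns
  are therefore the parallel classes of an affine resolution (and symmetrically); after adding
  both kinds, any two distinct cells share exactly \<open>\<mu>\<close> treatments, which is balance of the dual.
\<close>

section \<open>Affine resolutions given by a map from labels to parallel classes\<close>

lemma Plus_Int_Plus: "(A <+> B) \<inter> (C <+> D) = (A \<inter> C) <+> (B \<inter> D)"
  by auto

text \<open>The map \<open>f\<close> sends a label to its class, and \<open>I\<close> is the set of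
  classes. By \<open>once\<close>, each class covers each treatment by exactly one label, so the
  fibres of \<open>f\<close> form a resolution and the replication number \<open>r\<close> equals
  the number of classes.\<close>

lemma affine_resolvable_designI:
  assumes fin: "finite (treatments D)" "card (treatments D) = v"
    and lab: "finite (labels D)" "card (labels D) = b"
    and blk: "\<And>x. x \<in> labels D \<Longrightarrow> blk D x \<subseteq> treatments D \<and> card (blk D x) = k"
    and "0 < k" "k < v" "1 < r"
    and f: "f ` labels D = I" "card I = r"
    and once: "\<And>t c. t \<in> treatments D \<Longrightarrow> c \<in> I \<Longrightarrow> \<exists>!x. x \<in> labels D \<and> f x = c \<and> t \<in> blk D x"
    and "0 < m"
    and inter: "\<And>x y. x \<in> labels D \<Longrightarrow> y \<in> labels D \<Longrightarrow> f x \<noteq> f y \<Longrightarrow> card (blk D x \<inter> blk D y) = m"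
  shows "affine_resolvable_design D v b r k"
proof -
  have repl: "card {x \<in> labels D. t \<in> blk D x} = r" if t: "t \<in> treatments D" for t
  proof -
    have "bij_betw f {x \<in> labels D. t \<in> blk D x} I"
      unfolding bij_betw_def inj_on_def
    proof (intro conjI ballI impI)
      fix x y assume xy: "x \<in> {x \<in> labels D. t \<in> blk D x}" "y \<in> {x \<in> labels D. t \<in> blk D x}" "f x = f y"
      then have "f y \<in> I" using f(1) by blast
      from once[OF t this] xy show "x = y" by blast
    next
      show "f ` {x \<in> labels D. t \<in> blk D x} = I"
      proof
        show "I \<subseteq> f ` {x \<in> labels D. t \<in> blk D x}"
        proof
          fix c assume "c \<in> I"
          from once[OF t this] obtain x where "x \<in> labels D" "f x = c" "t \<in> blk D x" by blast
          then show "c \<in> f ` {x \<in> labels D. t \<in> blk D x}" by blast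
        qed
      qed (use f(1) in auto)
    qed
    then show ?thesis using f(2) by (simp add: bij_betw_same_card)
  qed
  define P where "P = (\<lambda>c. {x \<in> labels D. f x = c}) ` I"
  \<comment> \<open>Nonempty blocks are needed twice: a partition has no empty part, and two labels
    of one class with equal blocks are identified through a treatment that both contain.\<close>
  have nonempty: "blk D x \<noteq> {}" if "x \<in> labels D" for x
    using blk[OF that] \<open>0 < k\<close> by auto
  have parallel: "parallel_class D {x \<in> labels D. f x = c}" (is "parallel_class D ?C") if c: "c \<in> I" for c
    unfolding parallel_class_def
  proof (intro conjI)
    have same: "x = y" if "x \<in> ?C" "y \<in> ?C" "t \<in> blk D x" "t \<in> blk D y" for x y t
    proof -
      have "t \<in> treatments D" using that blk by blast
      from once[OF this c] that show ?thesis by blast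
    qed
    show "inj_on (blk D) ?C"
    proof (rule inj_onI)
      fix x y assume xy: "x \<in> ?C" "y \<in> ?C" "blk D x = blk D y"
      then obtain t where "t \<in> blk D x" using nonempty by blast
      with xy same show "x = y" by simp
    qed
    show "partition_on (treatments D) (blk D ` ?C)"
    proof (rule partition_onI)
      show "{} \<notin> blk D ` ?C" using nonempty by auto
      show "\<Union> (blk D ` ?C) = treatments D"
      proof
        show "\<Union> (blk D ` ?C) \<subseteq> treatments D" using blk by fast
        show "treatments D \<subseteq> \<Union> (blk D ` ?C)"
        proof
          fix t assume "t \<in> treatments D"
          from once[OF this c] show "t \<in> \<Union> (blk D ` ?C)" by blast
        qed
      qed
      show "\<And>p q. p \<in> blk D ` ?C \<Longrightarrow> q \<in> blk D ` ?C \<Longrightarrow> p \<noteq> q \<Longrightarrow> disjnt p q"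
        unfolding disjnt_def using same by blast
    qed
  qed auto
  \<comment> \<open>As \<open>f\<close> maps onto \<open>I\<close>, no fibre is empty, so different
    classes have different fibres and \<open>P\<close> has as many members as
    \<open>I\<close>.\<close>
  have "inj_on (\<lambda>c. {x \<in> labels D. f x = c}) I"
    using f(1) by (auto simp: inj_on_def)
  then have "card P = r" unfolding P_def using f(2) by (simp add: card_image)
  moreover have "partition_on (labels D) P"
  proof (rule partition_onI)
    show "{} \<notin> P" unfolding P_def f(1)[symmetric] by auto
    show "\<Union> P = labels D" unfolding P_def f(1)[symmetric] by auto
    show "\<And>p q. p \<in> P \<Longrightarrow> q \<in> P \<Longrightarrow> p \<noteq> q \<Longrightarrow> disjnt p q"
      unfolding P_def disjnt_def by auto
  qed
  ultimately have res: "resolution D r P"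
    unfolding resolution_def using parallel by (auto simp: P_def)
  have "\<forall>C \<in> P. \<forall>C' \<in> P. C \<noteq> C' \<longrightarrow> (\<forall>x \<in> C. \<forall>y \<in> C'. card (blk D x \<inter> blk D y) = m)"
    unfolding P_def by (auto intro: inter)
  moreover have "is_design D v b r k"
    unfolding is_design_def using fin lab blk repl by blast
  ultimately show ?thesis
    unfolding affine_resolvable_design_def resolvable_design_def
    using res \<open>k < v\<close> \<open>1 < r\<close> \<open>0 < m\<close> by blast
qed

section \<open>Uniform semi-Latin squares: transposition and intersection numbers\<close>

lemma uniform_semi_latin_squareD:
  assumes "uniform_semi_latin_square n k T S"
  shows "finite T" and "card T = n * k"
    and "i \<in> {1..n} \<Longrightarrow> j \<in> {1..n} \<Longrightarrow> S i j \<subseteq> T"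
    and "i \<in> {1..n} \<Longrightarrow> j \<in> {1..n} \<Longrightarrow> card (S i j) = k"
    and "t \<in> T \<Longrightarrow> i \<in> {1..n} \<Longrightarrow> \<exists>!j. j \<in> {1..n} \<and> t \<in> S i j"
    and "t \<in> T \<Longrightarrow> j \<in> {1..n} \<Longrightarrow> \<exists>!i. i \<in> {1..n} \<and> t \<in> S i j"
  using assms unfolding uniform_semi_latin_square_def semi_latin_square_def by simp_all

lemma uniform_semi_latin_square_finite_cell:
  assumes "uniform_semi_latin_square n k T S" and "i \<in> {1..n}" "j \<in> {1..n}"
  shows "finite (S i j)"
  by (rule finite_subset[OF uniform_semi_latin_squareD(3)[OF assms] uniform_semi_latin_squareD(1)[OF assms(1)]])

text \<open>The definition is symmetric in rows and columns. This transfers row statements to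
  columns, and later \<open>Delta1\<close> to \<open>Delta2\<close>.\<close>

lemma uniform_semi_latin_square_transpose:
  assumes "uniform_semi_latin_square n k T S"
  shows "uniform_semi_latin_square n k T (\<lambda>i j. S j i)"
proof -
  obtain m where "m > 0"
    and m: "\<forall>i \<in> {1..n}. \<forall>j \<in> {1..n}. \<forall>i' \<in> {1..n}. \<forall>j' \<in> {1..n}.
        i \<noteq> i' \<longrightarrow> j \<noteq> j' \<longrightarrow> card (S i j \<inter> S i' j') = m"
    using assms unfolding uniform_semi_latin_square_def by (elim conjE exE) rule
  have "\<forall>i \<in> {1..n}. \<forall>j \<in> {1..n}. \<forall>i' \<in> {1..n}. \<forall>j' \<in> {1..n}.
        i \<noteq> i' \<longrightarrow> j \<noteq> j' \<longrightarrow> card (S j i \<inter> S j' i') = m"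
    using m by simp
  moreover have "semi_latin_square n k T (\<lambda>i j. S j i)"
    using assms unfolding uniform_semi_latin_square_def semi_latin_square_def by simp
  ultimately show ?thesis
    unfolding uniform_semi_latin_square_def using \<open>m > 0\<close> by (intro conjI exI)
qed

text \<open>A common treatment would occur twice in row \<open>i\<close>.\<close>

lemma uniform_semi_latin_square_row_disjoint:
  assumes S: "uniform_semi_latin_square n k T S"
    and "i \<in> {1..n}" "j \<in> {1..n}" "j' \<in> {1..n}" "j \<noteq> j'"
  shows "S i j \<inter> S i j' = {}"
proof (rule ccontr)
  assume "S i j \<inter> S i j' \<noteq> {}"
  then obtain t where t: "t \<in> S i j" "t \<in> S i j'" by blast
  have "t \<in> T" using uniform_semi_latin_squareD(3)[OF S assms(2,3)] t by blast
  from uniform_semi_latin_squareD(5)[OF S this assms(2)] t assms(3-5) show False by blast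
qed

lemma uniform_semi_latin_square_column_disjoint:
  assumes "uniform_semi_latin_square n k T S"
    and "i \<in> {1..n}" "i' \<in> {1..n}" "j \<in> {1..n}" "i \<noteq> i'"
  shows "S i j \<inter> S i' j = {}"
  by (rule uniform_semi_latin_square_row_disjoint[OF
        uniform_semi_latin_square_transpose[OF assms(1)] assms(4,2,3,5)])

lemma uniform_semi_latin_square_inter:
  assumes n: "n > 2" and S: "uniform_semi_latin_square n (\<mu> * (n - 1)) T S"
    and ij: "i \<in> {1..n}" "j \<in> {1..n}" "i' \<in> {1..n}" "j' \<in> {1..n}" "i \<noteq> i'" "j \<noteq> j'"
  shows "card (S i j \<inter> S i' j') = \<mu>"
proof -
  obtain m where m: "\<And>i j i' j'. i \<in> {1..n} \<Longrightarrow> j \<in> {1..n} \<Longrightarrow> i' \<in> {1..n} \<Longrightarrow> j' \<in> {1..n} \<Longrightarrow>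
      i \<noteq> i' \<Longrightarrow> j \<noteq> j' \<Longrightarrow> card (S i j \<inter> S i' j') = m"
    using S unfolding uniform_semi_latin_square_def by metis
  have sub: "S i j \<subseteq> T" and card: "card (S i j) = \<mu> * (n - 1)" and fin: "finite (S i j)"
    using uniform_semi_latin_squareD(3,4)[OF S ij(1,2)]
      uniform_semi_latin_square_finite_cell[OF S ij(1,2)] .
  \<comment> \<open>The cells of row \<open>i'\<close> cut \<open>S i j\<close> into pieces. Column
    \<open>j\<close> contributes nothing, being disjoint from \<open>S i j\<close> in that row,
    which leaves \<open>n - 1\<close> pieces of size \<open>m\<close>.\<close>
  have "t \<in> (\<Union>l \<in> {1..n} - {j}. S i j \<inter> S i' l)" if t: "t \<in> S i j" for t
  proof -
    obtain l where "l \<in> {1..n}" "t \<in> S i' l"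
      using uniform_semi_latin_squareD(5)[OF S _ \<open>i' \<in> {1..n}\<close>] t sub by blast
    moreover have "S i j \<inter> S i' j = {}"
      by (rule uniform_semi_latin_square_column_disjoint[OF S ij(1,3,2,5)])
    ultimately show ?thesis using t by blast
  qed
  then have "S i j = (\<Union>l \<in> {1..n} - {j}. S i j \<inter> S i' l)" by blast
  then have "card (S i j) = card (\<Union>l \<in> {1..n} - {j}. S i j \<inter> S i' l)" by simp
  also have "\<dots> = (\<Sum>l \<in> {1..n} - {j}. card (S i j \<inter> S i' l))"
  proof (rule card_UN_disjoint)
    show "\<forall>l \<in> {1..n} - {j}. finite (S i j \<inter> S i' l)"
      using fin by simp
    show "\<forall>l \<in> {1..n} - {j}. \<forall>l' \<in> {1..n} - {j}. l \<noteq> l' \<longrightarrow>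
        S i j \<inter> S i' l \<inter> (S i j \<inter> S i' l') = {}"
      using uniform_semi_latin_square_row_disjoint[OF S \<open>i' \<in> {1..n}\<close>] by fast
  qed simp
  also have "\<dots> = (\<Sum>l \<in> {1..n} - {j}. m)"
    by (rule sum.cong) (use m ij in auto)
  also have "\<dots> = m * (n - 1)" using ij by simp
  \<comment> \<open>Cancellation is allowed because \<open>n - 1\<close> is positive.\<close>
  finally have "m = \<mu>" using card n by simp
  with m ij show ?thesis by blast
qed

section \<open>Incidence in the extended designs; affine resolvability of \<open>Delta1\<close> and
  \<open>Delta2\<close>\<close>

lemma treatments_Delta1: "treatments (Delta1 n \<mu> T S) = T <+> {1..n} \<times> {1..\<mu>}"
  and labels_Delta1: "labels (Delta1 n \<mu> T S) = {1..n} \<times> {1..n}"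
  and blk_Delta1: "i \<in> {1..n} \<Longrightarrow> j \<in> {1..n} \<Longrightarrow>
      blk (Delta1 n \<mu> T S) (i, j) = S i j <+> {i} \<times> {1..\<mu>}"
  unfolding Delta1_def add_rows_def add_treatments_def Delta_def by auto

lemma treatments_Delta2: "treatments (Delta2 n \<mu> T S) = T <+> {1..n} \<times> {1..\<mu>}"
  and labels_Delta2: "labels (Delta2 n \<mu> T S) = {1..n} \<times> {1..n}"
  and blk_Delta2: "i \<in> {1..n} \<Longrightarrow> j \<in> {1..n} \<Longrightarrow>
      blk (Delta2 n \<mu> T S) (i, j) = S i j <+> {j} \<times> {1..\<mu>}"
  unfolding Delta2_def add_columns_def add_treatments_def Delta_def by auto

text \<open>This form allows the parameters already found for \<open>Delta1\<close> to be reused: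
  only the column treatments remain to be added before dualizing.\<close>

lemma Delta3_eq: "Delta3 n \<mu> T S = dual_design (add_columns n \<mu> (Delta1 n \<mu> T S))"
  unfolding Delta3_def Delta1_def ..

lemma treatments_add_columns: "treatments (add_columns n \<mu> D) = treatments D <+> {1..n} \<times> {1..\<mu>}"
  and labels_add_columns: "labels (add_columns n \<mu> D) = labels D"
  and blk_add_columns: "i \<in> {1..n} \<Longrightarrow> j \<in> {1..n} \<Longrightarrow>
      blk (add_columns n \<mu> D) (i, j) = blk D (i, j) <+> {j} \<times> {1..\<mu>}"
  unfolding add_columns_def add_treatments_def by auto

text \<open>
  The bijection \<open>q\<close> gives row and column of a label; it is the identity for \<open>Delta1\<close> and the swap
  for \<open>Delta2\<close>, which is \<open>Delta1\<close> of the transposed square.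
\<close>

lemma affine_resolvable_add_rows:
  assumes n: "n > 2" and mu: "\<mu> \<ge> 1" and S: "uniform_semi_latin_square n (\<mu> * (n - 1)) T S"
    and treatments: "treatments D = T <+> {1..n} \<times> {1..\<mu>}"
    and q: "bij_betw q (labels D) ({1..n} \<times> {1..n})"
    and blk: "\<And>x i j. x \<in> labels D \<Longrightarrow> q x = (i, j) \<Longrightarrow> blk D x = S i j <+> {i} \<times> {1..\<mu>}"
  shows "affine_resolvable_design D (\<mu> * n\<^sup>2) (n\<^sup>2) n (\<mu> * n)"
\<comment> \<open>The class of a label is the second component under \<open>q\<close>, so blocks
  with the same first component, which share new treatments, lie in different classes.\<close>
proof (rule affine_resolvable_designI[where f = "snd \<circ> q" and I = "{1..n}" and m = \<mu>])
  note T = uniform_semi_latin_squareD(1,2)[OF S]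
  note cell = uniform_semi_latin_squareD(3,4)[OF S] uniform_semi_latin_square_finite_cell[OF S]
  have label: thesis
    if "x \<in> labels D" and "\<And>i j. q x = (i, j) \<Longrightarrow> i \<in> {1..n} \<Longrightarrow> j \<in> {1..n} \<Longrightarrow> thesis" for x thesis
  proof -
    obtain i j where "q x = (i, j)" by (cases "q x")
    moreover have "q x \<in> {1..n} \<times> {1..n}" using bij_betwE[OF q] that(1) by blast
    ultimately show thesis using that(2)[of i j] by simp
  qed
  \<comment> \<open>Old and new treatments are handled together: within class \<open>j\<close> it
    suffices that the index \<open>i\<close> is unique, since \<open>q\<close> then determines the
    label.\<close>
  have once: "\<exists>!x. x \<in> labels D \<and> (snd \<circ> q) x = j \<and> t \<in> blk D x"
    if j: "j \<in> {1..n}" and i: "i \<in> {1..n}" and t: "t \<in> S i j <+> {i} \<times> {1..\<mu>}"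
      and uniq: "\<And>i'. i' \<in> {1..n} \<Longrightarrow> t \<in> S i' j <+> {i'} \<times> {1..\<mu>} \<Longrightarrow> i' = i" for t i j
  proof -
    obtain x where x: "x \<in> labels D" "q x = (i, j)"
    proof -
      have "(i, j) \<in> q ` labels D" using q i j by (simp add: bij_betw_def)
      then show thesis using that by fastforce
    qed
    show ?thesis
    proof (rule ex1I[of _ x])
      show "x \<in> labels D \<and> (snd \<circ> q) x = j \<and> t \<in> blk D x"
        using x t blk[OF x] by simp
      fix y assume y: "y \<in> labels D \<and> (snd \<circ> q) y = j \<and> t \<in> blk D y"
      then have yl: "y \<in> labels D" by blast
      obtain i' j' where i': "q y = (i', j')" "i' \<in> {1..n}" "j' \<in> {1..n}" by (rule label[OF yl])
      then have "j' = j" using y by simp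
      moreover have "t \<in> S i' j' <+> {i'} \<times> {1..\<mu>}" using blk[OF yl i'(1)] y by simp
      ultimately have "i' = i" using uniq[OF i'(2)] by simp
      with \<open>j' = j\<close> have "q y = q x" using i'(1) x(2) by simp
      then show "y = x" using q yl x(1) unfolding bij_betw_def by (blast dest: inj_onD)
    qed
  qed
  \<comment> \<open>Removes the truncated subtraction \<open>n - 1\<close>, so that the counts
    \<open>n * \<mu> * (n - 1) + n * \<mu>\<close> of treatments and
    \<open>\<mu> * (n - 1) + \<mu>\<close> per block simplify.\<close>
  obtain n' where n': "n = Suc n'" using n by (cases n) auto
  show "finite (treatments D)" using T(1) by (simp add: treatments)
  show "card (treatments D) = \<mu> * n\<^sup>2"
    using T by (simp add: treatments card_Plus n' power2_eq_square algebra_simps)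
  show "finite (labels D)" "card (labels D) = n\<^sup>2"
    using bij_betw_finite[OF q] bij_betw_same_card[OF q] by (simp_all add: power2_eq_square)
  show "blk D x \<subseteq> treatments D \<and> card (blk D x) = \<mu> * n" if x: "x \<in> labels D" for x
  proof -
    obtain i j where ij: "q x = (i, j)" "i \<in> {1..n}" "j \<in> {1..n}"
      by (rule label[OF x])
    show ?thesis
      using cell[OF ij(2,3)] ij(2)
      by (auto simp: blk[OF x ij(1)] treatments card_Plus n' algebra_simps)
  qed
  show "0 < \<mu> * n" "1 < n" "0 < \<mu>" "\<mu> * n < \<mu> * n\<^sup>2"
    using n mu by (auto simp: power2_eq_square)
  have "(snd \<circ> q) ` labels D = snd ` q ` labels D" by (rule image_comp[symmetric])
  also have "\<dots> = snd ` ({1..n} \<times> {1..n})" by (simp only: bij_betw_imp_surj_on[OF q])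
  also have "\<dots> = {1..n}" using n by simp
  finally show "(snd \<circ> q) ` labels D = {1..n}" .
  show "card {1..n} = n" by simp
  show "\<exists>!x. x \<in> labels D \<and> (snd \<circ> q) x = j \<and> t \<in> blk D x"
    if t: "t \<in> treatments D" and j: "j \<in> {1..n}" for t j
  proof (cases t)
    case (Inl a)
    then have "a \<in> T" using t by (auto simp: treatments)
    from uniform_semi_latin_squareD(6)[OF S this j]
    obtain i where i: "i \<in> {1..n}" "a \<in> S i j"
      and uniq: "\<And>i'. i' \<in> {1..n} \<Longrightarrow> a \<in> S i' j \<Longrightarrow> i' = i" by blast
    show ?thesis
    proof (rule once[OF j i(1)])
      show "t \<in> S i j <+> {i} \<times> {1..\<mu>}" using i(2) Inl by auto
      fix i' assume i': "i' \<in> {1..n}" "t \<in> S i' j <+> {i'} \<times> {1..\<mu>}"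
      have "a \<in> S i' j" using i'(2) Inl by auto
      with i'(1) show "i' = i" by (rule uniq)
    qed
  next
    case (Inr a)
    then obtain i s where "a = (i, s)" "i \<in> {1..n}" "s \<in> {1..\<mu>}"
      using t by (auto simp: treatments)
    with Inr j show ?thesis by (intro once[of j i]) auto
  qed
  show "card (blk D x \<inter> blk D y) = \<mu>"
    if x: "x \<in> labels D" and y: "y \<in> labels D" and neq: "(snd \<circ> q) x \<noteq> (snd \<circ> q) y" for x y
  proof -
    obtain i j where ij: "q x = (i, j)" "i \<in> {1..n}" "j \<in> {1..n}"
      by (rule label[OF x])
    obtain i' j' where ij': "q y = (i', j')" "i' \<in> {1..n}" "j' \<in> {1..n}"
      by (rule label[OF y])
    have "j \<noteq> j'" using neq ij(1) ij'(1) by simp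
    \<comment> \<open>Old and new treatments are counted separately. For \<open>i = i'\<close> the
      summands are 0 and \<open>\<mu>\<close>, otherwise \<open>\<mu>\<close> and 0.\<close>
    have eq: "card (blk D x \<inter> blk D y) =
        card (S i j \<inter> S i' j') + card ({i} \<times> {1..\<mu>} \<inter> {i'} \<times> {1..\<mu>})"
      using cell(3)[OF ij(2,3)] by (simp add: blk[OF x ij(1)] blk[OF y ij'(1)] Plus_Int_Plus card_Plus)
    show ?thesis
    proof (cases "i = i'")
      case True
      then show ?thesis
        using eq uniform_semi_latin_square_row_disjoint[OF S ij(2,3) ij'(3) \<open>j \<noteq> j'\<close>] by simp
    next
      case False
      then have "{i} \<times> {1..\<mu>} \<inter> {i'} \<times> {1..\<mu>} = {}" by auto
      then show ?thesis
        using eq uniform_semi_latin_square_inter[OF n S ij(2,3) ij'(2,3) False \<open>j \<noteq> j'\<close>] by simp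
    qed
  qed
qed

lemma Delta1_affine_resolvable:
  assumes "n > 2" and "\<mu> \<ge> 1" and "uniform_semi_latin_square n (\<mu> * (n - 1)) T S"
  shows "affine_resolvable_design (Delta1 n \<mu> T S) (\<mu> * n\<^sup>2) (n\<^sup>2) n (\<mu> * n)"
  by (rule affine_resolvable_add_rows[OF assms, where q = id])
    (auto simp: treatments_Delta1 labels_Delta1 blk_Delta1)

lemma Delta2_affine_resolvable:
  assumes "n > 2" and "\<mu> \<ge> 1" and "uniform_semi_latin_square n (\<mu> * (n - 1)) T S"
  shows "affine_resolvable_design (Delta2 n \<mu> T S) (\<mu> * n\<^sup>2) (n\<^sup>2) n (\<mu> * n)"
  by (rule affine_resolvable_add_rows[OF assms(1,2) uniform_semi_latin_square_transpose[OF assms(3)],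
        where q = prod.swap])
    (auto simp: treatments_Delta2 labels_Delta2 blk_Delta2 bij_betw_def product_swap)

section \<open>Dual designs and balance of \<open>Delta3\<close>\<close>

lemma dual_design_BIBD:
  assumes D: "is_design D v b r k" and "1 < r" "r < b"
    and inter: "\<And>x y. x \<in> labels D \<Longrightarrow> y \<in> labels D \<Longrightarrow> x \<noteq> y \<Longrightarrow> card (blk D x \<inter> blk D y) = l"
  shows "is_BIBD (dual_design D) b v k r l"
proof -
  \<comment> \<open>The dual blocks through a point \<open>x\<close> are labelled by the elements of
    \<open>blk D x\<close>, and those through \<open>x\<close> and \<open>y\<close> by the
    intersection of their blocks. Thus constant block size becomes replication, and constant
    intersection size becomes balance.\<close>
  have "{t \<in> treatments D. t \<in> blk D x} = blk D x" if "x \<in> labels D" for x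
    using D that unfolding is_design_def by blast
  moreover have "{t \<in> treatments D. t \<in> blk D x \<and> t \<in> blk D y} = blk D x \<inter> blk D y"
    if "x \<in> labels D" for x y
    using D that unfolding is_design_def by blast
  ultimately show ?thesis
    using assms unfolding is_BIBD_def is_design_def dual_design_def by auto
qed

text \<open>Before dualizing, the column treatments enlarge \<open>Delta1\<close> to
  \<open>\<mu> * n\<^sup>2 + \<mu> * n\<close> treatments and each block to size
  \<open>\<mu> * n + \<mu>\<close>, while every treatment still lies in \<open>n\<close> blocks. The
  dual interchanges these parameters.\<close>

lemma Delta3_BIBD:
  assumes n: "n > 2" and mu: "\<mu> \<ge> 1" and S: "uniform_semi_latin_square n (\<mu> * (n - 1)) T S"
  shows "is_BIBD (Delta3 n \<mu> T S) (n\<^sup>2) (\<mu> * n * (n + 1)) (\<mu> * (n + 1)) n \<mu>"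
  unfolding Delta3_eq
proof (rule dual_design_BIBD)
  let ?E = "Delta1 n \<mu> T S" and ?D = "add_columns n \<mu> (Delta1 n \<mu> T S)"
  have E: "is_design ?E (\<mu> * n\<^sup>2) (n\<^sup>2) n (\<mu> * n)"
    using Delta1_affine_resolvable[OF n mu S]
    unfolding affine_resolvable_design_def resolvable_design_def by blast
  have finE: "finite (blk ?E x)" if "x \<in> labels ?E" for x
    using E that finite_subset unfolding is_design_def by blast
  have repl: "card {x \<in> labels ?D. t \<in> blk ?D x} = n" if t: "t \<in> treatments ?D" for t
  proof (cases t)
    case (Inl a)
    then have a: "a \<in> treatments ?E" using t by (auto simp: treatments_add_columns)
    have "{x \<in> labels ?D. t \<in> blk ?D x} = {x \<in> labels ?E. a \<in> blk ?E x}"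
      by (auto simp: Inl labels_add_columns labels_Delta1 blk_add_columns)
    then show ?thesis using E a unfolding is_design_def by simp
  next
    case (Inr a)
    then obtain j s where "a = (j, s)" and js: "j \<in> {1..n}" "s \<in> {1..\<mu>}"
      using t by (auto simp: treatments_add_columns)
    \<comment> \<open>A new column treatment lies in exactly the \<open>n\<close> cells of its
      column.\<close>
    then have "{x \<in> labels ?D. t \<in> blk ?D x} = {1..n} \<times> {j}"
      by (auto simp: Inr labels_add_columns labels_Delta1 blk_add_columns)
    then show ?thesis by (simp add: card_cartesian_product)
  qed
  have blk: "blk ?D x \<subseteq> treatments ?D \<and> card (blk ?D x) = \<mu> * (n + 1)" if x: "x \<in> labels ?D" for x
  proof -
    obtain i j where x: "x = (i, j)" and ij: "i \<in> {1..n}" "j \<in> {1..n}"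
      using x by (auto simp: labels_add_columns labels_Delta1)
    have "(i, j) \<in> labels ?E" using ij by (simp add: labels_Delta1)
    then have "blk ?E (i, j) \<subseteq> treatments ?E" "card (blk ?E (i, j)) = \<mu> * n" "finite (blk ?E (i, j))"
      using E finE unfolding is_design_def by blast+
    with ij(2) show ?thesis
      by (auto simp: x blk_add_columns[OF ij] treatments_add_columns card_Plus)
  qed
  have "card (treatments ?D) = \<mu> * n * (n + 1)"
    using E unfolding is_design_def
    by (simp add: treatments_add_columns card_Plus power2_eq_square algebra_simps)
  moreover have "finite (treatments ?D)" "finite (labels ?D)" "card (labels ?D) = n\<^sup>2"
    using E unfolding is_design_def by (simp_all add: treatments_add_columns labels_add_columns)
  ultimately show "is_design ?D (\<mu> * n * (n + 1)) (n\<^sup>2) n (\<mu> * (n + 1))"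
    unfolding is_design_def using blk repl by blast
  \<comment> \<open>In the dual, \<open>n\<close> is the block size and \<open>n\<^sup>2\<close> the
    number of points, so these are the bounds that a BIBD requires.\<close>
  show "1 < n" "n < n\<^sup>2" using n by (auto simp: power2_eq_square)
  show "card (blk ?D x \<inter> blk ?D y) = \<mu>"
    if xy: "x \<in> labels ?D" "y \<in> labels ?D" "x \<noteq> y" for x y
  proof -
    have "x \<in> {1..n} \<times> {1..n}" "y \<in> {1..n} \<times> {1..n}"
      using xy by (simp_all add: labels_add_columns labels_Delta1)
    then obtain i j i' j' where x: "x = (i, j)" and y: "y = (i', j')"
      and ij: "i \<in> {1..n}" "j \<in> {1..n}" and ij': "i' \<in> {1..n}" "j' \<in> {1..n}"
      by blast
    \<comment> \<open>The summands count common original, row and column treatments. For distinct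
      cells exactly one of them is \<open>\<mu>\<close> and the others vanish: the row one in a
      common row, the column one in a common column, the original one otherwise.\<close>
    have eq: "card (blk ?D x \<inter> blk ?D y) = card (S i j \<inter> S i' j') +
        card ({i} \<times> {1..\<mu>} \<inter> {i'} \<times> {1..\<mu>}) + card ({j} \<times> {1..\<mu>} \<inter> {j'} \<times> {1..\<mu>})"
      using uniform_semi_latin_square_finite_cell[OF S ij]
      by (simp add: x y blk_add_columns[OF ij] blk_add_columns[OF ij'] blk_Delta1[OF ij]
          blk_Delta1[OF ij'] Plus_Int_Plus card_Plus)
    have strips: "{a} \<times> {1..\<mu>} \<inter> {a'} \<times> {1..\<mu>} = {}" if "a \<noteq> a'" for a a' :: nat
      using that by auto
    consider "i = i'" "j \<noteq> j'" | "i \<noteq> i'" "j = j'" | "i \<noteq> i'" "j \<noteq> j'"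
      using \<open>x \<noteq> y\<close> x y by blast
    then show ?thesis
    proof cases
      case 1
      then show ?thesis
        using eq strips uniform_semi_latin_square_row_disjoint[OF S ij ij'(2)] by simp
    next
      case 2
      then show ?thesis
        using eq strips uniform_semi_latin_square_column_disjoint[OF S ij(1) ij'(1) ij(2)] by simp
    next
      case 3
      then show ?thesis
        using eq strips uniform_semi_latin_square_inter[OF n S ij ij'] by simp
    qed
  qed
qed

theorem mainTheorem8:
  fixes n \<mu> :: nat and T :: "'t set" and S :: "nat \<Rightarrow> nat \<Rightarrow> 't set"
  assumes "n > 2" and "\<mu> \<ge> 1"
    and "uniform_semi_latin_square n (\<mu> * (n - 1)) T S"
  shows "affine_resolvable_design (Delta1 n \<mu> T S) (\<mu> * n\<^sup>2) (n\<^sup>2) n (\<mu> * n) \<and>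
         affine_resolvable_design (Delta2 n \<mu> T S) (\<mu> * n\<^sup>2) (n\<^sup>2) n (\<mu> * n) \<and>
         is_BIBD (Delta3 n \<mu> T S) (n\<^sup>2) (\<mu> * n * (n + 1)) (\<mu> * (n + 1)) n \<mu>"
  using Delta1_affine_resolvable[OF assms] Delta2_affine_resolvable[OF assms] Delta3_BIBD[OF assms]
  by blast

end
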